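(* Let $n\ge1$, $m\ge0$, $d=n+m$, and let $H\in\mathbb{Z}^{d\times n}$ be a matrix of rank $n$ in reduced Hermite normal form such that $H$ has no singular $n\times n$ submatrices. Let $\Delta=\Delta(H)$. If $n>\Delta(2\Delta+1)^2+\log_2\Delta$, then $H$ has at most $n+1$ rows.
   Context: For an integer matrix $A$, $\Delta_k(A)$ is the greatest absolute value of the determinants of all $k\times k$ submatrices of $A$, and $\Delta(A)=\Delta_{\mathrm{rank}(A)}(A)$. Reduced Hermite normal form: write $H_B$ for the $n\times n$ matrix of the first $n$ rows of $H$ and $H_N$ for the $m\times n$ matrix of its remaining rows. $H$ is in reduced Hermite normal form if $H_B$ is non-singular and lower triangular, $0\le H_{ij}<H_{ii}$ for all $1\le j<i\le n$, and there is $s\in\{0,\dots,n\}$ with $H_{ii}=1$ for $i\le s$ and $H_{ii}\ge 2$ for $s<i\le n$ (so the first $s$ rows of $H_B$ are those of the identity matrix). *)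

theory Defs
  imports
    "Jordan_Normal_Form.DL_Submatrix"
    "Jordan_Normal_Form.DL_Rank"
    "Jordan_Normal_Form.Determinant"
    Complex_Main
begin

text \<open>Rows and columns are indexed from 0. The rank of an integer matrix is its rank over the
  rational numbers.\<close>

definition int_rank :: "int mat \<Rightarrow> nat" where
  "int_rank A = vec_space.rank (dim_row A) (map_mat rat_of_int A)"

definition square_submatrices :: "nat \<Rightarrow> 'a mat \<Rightarrow> 'a mat set" where
  "square_submatrices k A = {submatrix A I J | I J.
     I \<subseteq> {..<dim_row A} \<and> J \<subseteq> {..<dim_col A} \<and> card I = k \<and> card J = k}"

text \<open>Meaningful only for \<open>k \<le> min (dim_row A) (dim_col A)\<close>; otherwise the set is empty
  and its maximum unspecified.\<close>

definition max_minor :: "nat \<Rightarrow> int mat \<Rightarrow> int" where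
  "max_minor k A = Max ((\<lambda>B. \<bar>det B\<bar>) ` square_submatrices k A)"

definition Delta :: "int mat \<Rightarrow> int" where
  "Delta A = max_minor (int_rank A) A"

lemma finite_square_submatrices: "finite (square_submatrices k A)"
proof -
  have "square_submatrices k A \<subseteq>
    (\<lambda>(I, J). submatrix A I J) ` (Pow {..<dim_row A} \<times> Pow {..<dim_col A})"
    unfolding square_submatrices_def by auto
  then show ?thesis
    by (rule finite_subset) auto
qed

lemma square_submatrices_nonempty:
  assumes "k \<le> dim_row A" "k \<le> dim_col A"
  shows "square_submatrices k A \<noteq> {}"
proof -
  have "submatrix A {..<k} {..<k} \<in> square_submatrices k A"
    unfolding square_submatrices_def using assms
    by (intro CollectI exI[of _ "{..<k}"]) auto
  then show ?thesis by blast
qed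

definition top_block :: "'a mat \<Rightarrow> 'a mat" where
  "top_block H = mat (dim_col H) (dim_col H) (\<lambda>(i, j). H $$ (i, j))"

definition lower_triangular_mat :: "'a :: zero mat \<Rightarrow> bool" where
  "lower_triangular_mat A \<longleftrightarrow>
     (\<forall>i j. i < dim_row A \<and> j < dim_col A \<and> i < j \<longrightarrow> A $$ (i, j) = 0)"

text \<open>The rows below the top block are unconstrained.\<close>

definition reduced_hermite_normal_form :: "int mat \<Rightarrow> bool" where
  "reduced_hermite_normal_form H \<longleftrightarrow>
     (let n = dim_col H in
        n \<le> dim_row H \<and>
        det (top_block H) \<noteq> 0 \<and>
        lower_triangular_mat (top_block H) \<and>
        (\<forall>i j. j < i \<and> i < n \<longrightarrow> 0 \<le> H $$ (i, j) \<and> H $$ (i, j) < H $$ (i, i)) \<and>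
        (\<exists>s \<le> n. (\<forall>i < s. H $$ (i, i) = 1) \<and>
                 (\<forall>i. s \<le> i \<and> i < n \<longrightarrow> 2 \<le> H $$ (i, i))))"

end

theory Submission
  imports Defs
begin

text \<open>Suppose there are two rows \<open>a\<close>, \<open>b\<close> below the top block \<open>B\<close>. Replacing row \<open>i\<close> of \<open>B\<close> by \<open>a\<close>
  or by \<open>b\<close> gives a pair of minors in \<open>[-\<Delta>, \<Delta>]\<^sup>2\<close>. As \<open>n > (2\<Delta> + 1)\<^sup>2\<close>, two indices \<open>i \<noteq> j\<close> yield
  the same pair. The difference of the cofactor vectors of rows \<open>i\<close> and \<open>j\<close> of \<open>B\<close> is then a nonzero
  vector orthogonal to \<open>a\<close>, to \<open>b\<close>, and to every row of \<open>B\<close> other than rows \<open>i\<close> and \<open>j\<close>, so the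
  submatrix consisting of these rows is singular.\<close>

text \<open>Rows are listed by a function, not by an index set as in \<open>submatrix\<close>, so
  that replacing one row in place is the update \<open>f(i := l)\<close>.\<close>

definition select_rows :: "nat \<Rightarrow> 'a mat \<Rightarrow> (nat \<Rightarrow> nat) \<Rightarrow> 'a mat" where
  "select_rows n A f = mat n n (\<lambda>(i, j). A $$ (f i, j))"

lemma select_rows_carrier [simp]: "select_rows n A f \<in> carrier_mat n n"
  by (simp add: select_rows_def)

text \<open>\<open>submatrix\<close> lists the chosen rows in increasing order, \<open>f\<close> in
  any order. The two matrices differ by a row permutation, whose sign is
  \<open>\<epsilon>\<close>.\<close>

lemma select_rows_square_submatrix:
  fixes A :: "'a :: comm_ring_1 mat"
  assumes A: "A \<in> carrier_mat d n" and inj: "inj_on f {..<n}" and f: "f ` {..<n} \<subseteq> {..<d}"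
  obtains B \<epsilon> where "B \<in> square_submatrices n A" "\<epsilon> = 1 \<or> \<epsilon> = -1"
    "det (select_rows n A f) = \<epsilon> * det B"
proof -
  define I where "I = f ` {..<n}"
  define B where "B = submatrix A I {..<n}"
  have cardI: "card I = n"
    using inj by (simp add: I_def card_image)
  have finI: "finite I"
    by (simp add: I_def)
  have rows: "{i. i < dim_row A \<and> i \<in> I} = I" and cols: "{j. j < dim_col A \<and> j \<in> {..<n}} = {..<n}"
    using A f by (auto simp: I_def)
  have B: "B \<in> carrier_mat n n"
    unfolding B_def by (intro carrier_matI) (simp_all only: dim_submatrix rows cols cardI card_lessThan)
  have pick_cols: "pick {..<n} j = j" if "j < n" for j
  proof -
    have "{a \<in> {..<n}. a < j} = {..<j}"
      using that by auto
    then show ?thesis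
      using pick_card_in_set[of j "{..<n}"] that by simp
  qed
  have entry: "B $$ (i, j) = A $$ (pick I i, j)" if "i < n" "j < n" for i j
    using that submatrix_index[of i A I j "{..<n}"] unfolding B_def rows cols
    by (simp add: cardI pick_cols)
  \<comment> \<open>The rank of \<open>f i\<close> among the chosen rows, which
    \<open>pick I\<close> inverts; the identity outside \<open>{..<n}\<close> makes \<open>p\<close>
    a permutation.\<close>
  define p where "p i = (if i < n then card {a \<in> I. a < f i} else i)" for i
  have p_less: "p i < n" if "i < n" for i
  proof -
    have "{a \<in> I. a < f i} \<subset> I"
      using that by (auto simp: I_def)
    then show ?thesis
      using psubset_card_mono[OF finI] that by (simp add: p_def cardI)
  qed
  have pick_p: "pick I (p i) = f i" if "i < n" for i
    using that by (auto simp: p_def I_def intro!: pick_card_in_set)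
  have "inj_on p {..<n}"
  proof (rule inj_onI)
    fix i j assume ij: "i \<in> {..<n}" "j \<in> {..<n}" "p i = p j"
    then have "f i = f j"
      using pick_p by (metis lessThan_iff)
    then show "i = j"
      using inj ij by (auto dest: inj_onD)
  qed
  then have perm: "p permutes {0..<n}"
    using p_less by (intro inj_imp_permutes) (auto simp: p_def atLeast0LessThan)
  have "select_rows n A f = mat n n (\<lambda>(i, j). B $$ (p i, j))"
    by (rule eq_matI) (auto simp: select_rows_def entry p_less pick_p)
  then have "det (select_rows n A f) = signof p * det B"
    using det_permute_rows[OF B perm] by simp
  moreover have "B \<in> square_submatrices n A"
    using A f cardI unfolding square_submatrices_def B_def
    by (intro CollectI exI[of _ I] exI[of _ "{..<n}"]) (auto simp: I_def)
  ultimately show thesis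
    using that[of B "signof p"] by (auto simp: sign_def)
qed

lemma abs_minor_le_max_minor: "B \<in> square_submatrices k A \<Longrightarrow> \<bar>det B\<bar> \<le> max_minor k A"
  unfolding max_minor_def by (intro Max_ge finite_imageI finite_square_submatrices imageI)

text \<open>The cofactors along row \<open>i\<close> do not see row \<open>i\<close>, so they also
  serve in the Laplace expansion after that row is replaced.\<close>

lemma sum_cofactor_select_rows:
  fixes A :: "'a :: comm_ring_1 mat"
  assumes i: "i < n"
  shows "(\<Sum>k<n. A $$ (l, k) * cofactor (select_rows n A f) i k) = det (select_rows n A (f(i := l)))"
proof -
  let ?M = "select_rows n A f" and ?N = "select_rows n A (f(i := l))"
  have "mat_delete ?N i k = mat_delete ?M i k" for k
    by (rule eq_matI) (auto simp: mat_delete_def select_rows_def)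
  then have "cofactor ?N i k = cofactor ?M i k" for k
    by (simp add: cofactor_def)
  moreover have "det ?N = (\<Sum>k<n. ?N $$ (i, k) * cofactor ?N i k)"
    using i by (intro laplace_expansion_row) auto
  ultimately show ?thesis
    using i by (simp add: select_rows_def)
qed

lemma det_select_rows_repeated:
  fixes A :: "'a :: comm_ring_1 mat"
  assumes "i < n" "j < n" "i \<noteq> j" "f i = f j"
  shows "det (select_rows n A f) = 0"
  using assms
  by (intro det_identical_rows[of _ n i j]) (auto simp: select_rows_def)

lemma det_select_rows_two_replaced:
  fixes A :: "'a :: idom mat"
  assumes ij: "i < n" "j < n" "i \<noteq> j"
    and a: "det (select_rows n A (f(i := a))) = det (select_rows n A (f(j := a)))"
    and b: "det (select_rows n A (f(i := b))) = det (select_rows n A (f(j := b)))"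
    and nonzero: "det (select_rows n A f) \<noteq> 0"
  shows "det (select_rows n A (f(i := a, j := b))) = 0"
proof -
  let ?M = "select_rows n A f" and ?N = "select_rows n A (f(i := a, j := b))"
  define y where "y = vec n (\<lambda>k. cofactor ?M i k - cofactor ?M j k)"
  have dot: "(\<Sum>k<n. A $$ (l, k) * y $ k) =
      det (select_rows n A (f(i := l))) - det (select_rows n A (f(j := l)))" for l
    using sum_cofactor_select_rows[OF ij(1), of A l f] sum_cofactor_select_rows[OF ij(2), of A l f]
    by (simp add: y_def right_diff_distrib sum_subtractf)
  have repeated: "det (select_rows n A (f(k := f l))) = 0" if "k < n" "l < n" "k \<noteq> l" for k l
    using that by (intro det_select_rows_repeated[of k n l]) auto
  \<comment> \<open>Putting \<open>f i\<close> at position \<open>i\<close> changes nothing, while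
    putting it at position \<open>j\<close> repeats a row. So \<open>y\<close> has a nonzero product
    with row \<open>f i\<close>.\<close>
  have "(\<Sum>k<n. A $$ (f i, k) * y $ k) = det ?M"
    unfolding dot using repeated[of j i] ij by simp
  then have "y \<noteq> 0\<^sub>v n"
    using nonzero by auto
  moreover have "?N *\<^sub>v y = 0\<^sub>v n"
  proof (rule eq_vecI)
    fix r assume r: "r < dim_vec (0\<^sub>v n :: 'a vec)"
    have "(?N *\<^sub>v y) $ r = (\<Sum>k<n. A $$ ((f(i := a, j := b)) r, k) * y $ k)"
      using r by (simp add: select_rows_def scalar_prod_def y_def atLeast0LessThan)
    \<comment> \<open>Positions \<open>i\<close> and \<open>j\<close> hold \<open>a\<close> and
      \<open>b\<close>, where the two determinants agree by assumption; for any other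
      \<open>r\<close>, both determinants have row \<open>f r\<close> twice.\<close>
    also have "\<dots> = 0"
      unfolding dot using a b r repeated[of i r] repeated[of j r] ij by auto
    finally show "(?N *\<^sub>v y) $ r = 0\<^sub>v n $ r"
      using r by simp
  qed (simp add: select_rows_def)
  moreover have "y \<in> carrier_vec n"
    by (simp add: y_def)
  ultimately show ?thesis
    by (subst det_0_iff_vec_prod_zero[of _ n]) auto
qed

theorem lemma3:
  fixes n m d :: nat and H :: "int mat"
  assumes "n \<ge> 1"
    and "d = n + m"
    and "H \<in> carrier_mat d n"
    and "int_rank H = n"
    and "reduced_hermite_normal_form H"
    and "\<forall>B \<in> square_submatrices n H. det B \<noteq> 0"
    and "real n > real_of_int (Delta H) * (2 * real_of_int (Delta H) + 1)\<^sup>2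
                    + log 2 (real_of_int (Delta H))"
  shows "dim_row H \<le> n + 1"
proof (rule ccontr)
  assume "\<not> dim_row H \<le> n + 1"
  then have d: "n + 2 \<le> d"
    using assms(3) by auto
  define \<Delta> where "\<Delta> = Delta H"
  \<comment> \<open>As the rank is \<open>n\<close>, \<open>Delta H\<close> bounds exactly the
    minors of order \<open>n\<close>.\<close>
  have minor: "det (select_rows n H f) \<noteq> 0 \<and> \<bar>det (select_rows n H f)\<bar> \<le> \<Delta>"
    if "inj_on f {..<n}" "f ` {..<n} \<subseteq> {..<d}" for f
  proof -
    obtain B \<epsilon> where "B \<in> square_submatrices n H" "\<epsilon> = 1 \<or> \<epsilon> = -1"
      "det (select_rows n H f) = \<epsilon> * det B"
      using select_rows_square_submatrix[OF assms(3) \<open>inj_on f {..<n}\<close> \<open>f ` {..<n} \<subseteq> {..<d}\<close>] .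
    then show ?thesis
      using assms(4,6) abs_minor_le_max_minor[of B n H] by (auto simp: \<Delta>_def Delta_def)
  qed
  have top: "det (select_rows n H id) \<noteq> 0" and "\<Delta> \<ge> 1"
    using minor[of id] d by fastforce+
  define D where "D l i = det (select_rows n H (id(i := l)))" for l i
  have D: "D l i \<in> {-\<Delta>..\<Delta>}" if "i < n" "n \<le> l" "l < d" for l i
  proof -
    have "inj_on (id(i := l)) {..<n}" "id(i := l) ` {..<n} \<subseteq> {..<d}"
      using that d by (auto simp: inj_on_def)
    then show ?thesis
      using minor[of "id(i := l)"] by (auto simp: D_def abs_le_iff)
  qed
  \<comment> \<open>There are \<open>(2 * \<Delta> + 1)\<^sup>2\<close> possible pairs; since
    \<Delta> \<ge> 1, the assumed bound on \<open>n\<close> exceeds this number.\<close>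
  have "int (card ({-\<Delta>..\<Delta>} \<times> {-\<Delta>..\<Delta>})) < int n"
  proof -
    have "(2 * real_of_int \<Delta> + 1)\<^sup>2 \<le> real_of_int \<Delta> * (2 * real_of_int \<Delta> + 1)\<^sup>2"
      using \<open>\<Delta> \<ge> 1\<close> by (simp add: mult_le_cancel_right1)
    moreover have "0 \<le> log 2 (real_of_int \<Delta>)"
      using \<open>\<Delta> \<ge> 1\<close> by simp
    ultimately have "(2 * real_of_int \<Delta> + 1)\<^sup>2 < real n"
      using assms(7) unfolding \<Delta>_def by linarith
    then have "real_of_int ((2 * \<Delta> + 1)\<^sup>2) < real_of_int (int n)"
      by simp
    then have "(2 * \<Delta> + 1)\<^sup>2 < int n"
      by linarith
    then show ?thesis
      using \<open>\<Delta> \<ge> 1\<close> by (simp add: card_cartesian_product power2_eq_square algebra_simps)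
  qed
  \<comment> \<open>With indices from 0, \<open>n\<close> and \<open>Suc n\<close> are the first two
    rows below the top block.\<close>
  moreover have "(\<lambda>i. (D n i, D (Suc n) i)) ` {..<n} \<subseteq> {-\<Delta>..\<Delta>} \<times> {-\<Delta>..\<Delta>}"
    using D[of _ n] D[of _ "Suc n"] d by (intro image_subsetI SigmaI) simp_all
  ultimately have "\<not> inj_on (\<lambda>i. (D n i, D (Suc n) i)) {..<n}"
    using card_inj_on_le[of "\<lambda>i. (D n i, D (Suc n) i)" "{..<n}" "{-\<Delta>..\<Delta>} \<times> {-\<Delta>..\<Delta>}"]
    by (metis card_lessThan finite_SigmaI finite_atLeastAtMost_int linorder_not_less of_nat_less_iff)
  then obtain i j where ij: "i < n" "j < n" "i \<noteq> j"
    and "D n i = D n j" "D (Suc n) i = D (Suc n) j"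
    by (auto simp: inj_on_def)
  then have "det (select_rows n H (id(i := n, j := Suc n))) = 0"
    using top by (intro det_select_rows_two_replaced) (simp_all add: D_def)
  moreover have "inj_on (id(i := n, j := Suc n)) {..<n}"
    "id(i := n, j := Suc n) ` {..<n} \<subseteq> {..<d}"
    using ij d by (auto simp: inj_on_def)
  ultimately show False
    using minor by blast
qed

end
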